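(* Let $G$ be an amenable topological group and let $G\curvearrowright X$ be a continuous isometric action on a metric space $X$. Assume that the real vector space $\mathrm{Hom}(G,\mathbb{R})$ of continuous homomorphisms from $G$ to $\mathbb{R}$ is finite-dimensional. Then the closed linear subspace $$\{\phi\in\mathfrak{Lip}(X)\mid \phi\text{ is constant on every orbit of }G\curvearrowright X\}$$ is complemented in $\mathfrak{Lip}(X)$.
   Context: A topological group $G$ is amenable if every continuous affine action of $G$ on a non-empty compact convex subset of a locally convex topological vector space has a fixed point. Equivalently, there is a mean $\mathfrak m$ (positive linear functional of norm $1$ with $\mathfrak m(\mathbf 1)=1$) on the algebra $\mathsf{LUCB}(G)$ of bounded functions $\phi:G\to\mathbb R$ for which $g\mapsto\phi(\,\cdot\,g)$ is continuous in the sup norm, such that $\mathfrak m(\phi(\,\cdot\, g))=\mathfrak m(\phi)$ for all $g\in G$. For a metric space $X$, $\mathsf{Lip}(X)$ is the vector space of all real-valued Lipschitz functions on $X$, and $\mathfrak{Lip}(X)=\mathsf{Lip}(X)/\{\text{constant functions}\}$, a Banach space under the norm $L(\phi)=\sup_{x\ne y}|\phi(x)-\phi(y)|/d(x,y)$ (optimal Lipschitz constant). Elements of $\mathfrak{Lip}(X)$ are identified with their representatives in $\mathsf{Lip}(X)$; being constant on every orbit does not depend on the representative. A closed subspace is complemented if it is the range of a bounded linear projection. *)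

theory Defs
  imports "HOL-Analysis.Analysis"
begin

text \<open>
  Topological groups are modelled by the class \<open>topological_group_add\<close>, which assumes
  neither commutativity nor the Hausdorff property: the group law is written \<open>+\<close>, the
  neutral element \<open>0\<close>, and the product \<open>x g\<close> of the usual notation is \<open>x + g\<close>.
\<close>

text \<open>
  The uniform limit expresses continuity, at the point \<open>g\<close> and with respect to the sup norm,
  of the map sending \<open>h\<close> to the right translate of \<open>\<phi>\<close> by \<open>h\<close>.
\<close>

definition LUCB :: "('g::topological_group_add \<Rightarrow> real) set" where
  "LUCB = {\<phi>. bounded (range \<phi>) \<and>
              (\<forall>g. uniform_limit UNIV (\<lambda>h x. \<phi> (x + h)) (\<lambda>x. \<phi> (x + g)) (nhds g))}"

text \<open>
  A mean is only relevant through its values on \<open>LUCB\<close>. The fourth condition says that its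
  norm as a functional for the sup norm is at most 1; with the last one, it is equal to 1.
\<close>

definition mean_on_LUCB :: "(('g::topological_group_add \<Rightarrow> real) \<Rightarrow> real) \<Rightarrow> bool" where
  "mean_on_LUCB m \<longleftrightarrow>
     (\<forall>\<phi>\<in>LUCB. \<forall>\<psi>\<in>LUCB. m (\<lambda>x. \<phi> x + \<psi> x) = m \<phi> + m \<psi>) \<and>
     (\<forall>\<phi>\<in>LUCB. \<forall>c. m (\<lambda>x. c * \<phi> x) = c * m \<phi>) \<and>
     (\<forall>\<phi>\<in>LUCB. (\<forall>x. 0 \<le> \<phi> x) \<longrightarrow> 0 \<le> m \<phi>) \<and>
     (\<forall>\<phi>\<in>LUCB. \<bar>m \<phi>\<bar> \<le> (SUP x. \<bar>\<phi> x\<bar>)) \<and>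
     m (\<lambda>x. 1) = 1"

text \<open>
  The fixed point property for affine actions quantifies over all locally convex spaces, of
  arbitrary type, and so is not a HOL predicate of the group. Amenability is therefore
  taken in its equivalent form, the existence of an invariant mean on \<open>LUCB\<close>.
\<close>

definition amenable :: "'g::topological_group_add itself \<Rightarrow> bool" where
  "amenable _ \<longleftrightarrow>
     (\<exists>m :: ('g \<Rightarrow> real) \<Rightarrow> real.
        mean_on_LUCB m \<and> (\<forall>\<phi>\<in>LUCB. \<forall>g. m (\<lambda>x. \<phi> (x + g)) = m \<phi>))"

definition real_homs :: "('g::topological_group_add \<Rightarrow> real) set" where
  "real_homs = {\<eta>. continuous_on UNIV \<eta> \<and> (\<forall>g h. \<eta> (g + h) = \<eta> g + \<eta> h)}"

text \<open>
  Function types carry no real vector space structure in the library, so the existence of a finite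
  spanning set is written out.
\<close>

definition finite_dim_real_homs :: "'g::topological_group_add itself \<Rightarrow> bool" where
  "finite_dim_real_homs _ \<longleftrightarrow>
     (\<exists>B :: ('g \<Rightarrow> real) set. finite B \<and> B \<subseteq> real_homs \<and>
        (\<forall>\<eta>\<in>real_homs. \<exists>c. \<forall>g. \<eta> g = (\<Sum>b\<in>B. c b * b g)))"

definition continuous_isometric_action ::
    "('g::topological_group_add \<Rightarrow> 'x::metric_space \<Rightarrow> 'x) \<Rightarrow> bool" where
  "continuous_isometric_action act \<longleftrightarrow>
     (\<forall>x. act 0 x = x) \<and>
     (\<forall>g h x. act (g + h) x = act g (act h x)) \<and>
     (\<forall>g x y. dist (act g x) (act g y) = dist x y) \<and>
     continuous_on UNIV (\<lambda>(g, x). act g x)"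

definition action_orbit :: "('g \<Rightarrow> 'x \<Rightarrow> 'x) \<Rightarrow> 'x \<Rightarrow> 'x set" where
  "action_orbit act x = range (\<lambda>g. act g x)"

definition Lip :: "('x::metric_space \<Rightarrow> real) set" where
  "Lip = {\<phi>. \<exists>C. C-lipschitz_on UNIV \<phi>}"

text \<open>
  The supremum is over all pairs: the diagonal contributes the value \<open>0 / 0 = 0\<close>, which only
  matters when the space is a single point.
\<close>

definition Lip_const :: "('x::metric_space \<Rightarrow> real) \<Rightarrow> real" where
  "Lip_const \<phi> = (SUP (x, y). \<bar>\<phi> x - \<phi> y\<bar> / dist x y)"

lemma LipE:
  assumes "\<phi> \<in> Lip"
  obtains C where "0 \<le> C" "\<And>x y. \<bar>\<phi> x - \<phi> y\<bar> \<le> C * dist x y"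
  using assms by (auto simp: Lip_def lipschitz_on_def dist_real_def)

lemma LipI:
  assumes "\<And>x y. \<bar>\<phi> x - \<phi> y\<bar> \<le> C * dist x y"
  shows "\<phi> \<in> Lip"
proof -
  have "\<bar>\<phi> x - \<phi> y\<bar> \<le> max C 0 * dist x y" for x y
    by (rule order_trans[OF assms]) (simp add: mult_right_mono)
  then have "(max C 0)-lipschitz_on UNIV \<phi>"
    by (intro lipschitz_onI) (auto simp: dist_real_def)
  then show ?thesis by (auto simp: Lip_def)
qed

lemma Lip_const_bound:
  assumes "\<phi> \<in> Lip"
  shows "\<bar>\<phi> x - \<phi> y\<bar> \<le> Lip_const \<phi> * dist x y"
proof (cases "x = y")
  case False
  obtain C where C: "0 \<le> C" "\<And>x y. \<bar>\<phi> x - \<phi> y\<bar> \<le> C * dist x y"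
    using LipE[OF assms] by blast
  have "bdd_above (range (\<lambda>(x, y). \<bar>\<phi> x - \<phi> y\<bar> / dist x y))"
    using C by (intro bdd_aboveI[of _ C]) (auto simp: divide_le_eq)
  from cSUP_upper[OF _ this, of "(x, y)"]
  have "\<bar>\<phi> x - \<phi> y\<bar> / dist x y \<le> Lip_const \<phi>" by (simp add: Lip_const_def)
  with False show ?thesis by (simp add: divide_le_eq)
qed simp

lemma Lip_const_least:
  assumes "0 \<le> C" "\<And>x y. \<bar>\<phi> x - \<phi> y\<bar> \<le> C * dist x y"
  shows "Lip_const \<phi> \<le> C"
  unfolding Lip_const_def by (rule cSUP_least) (use assms in \<open>auto simp: divide_le_eq\<close>)

lemma Lip_const_nonneg:
  assumes "\<phi> \<in> Lip"
  shows "0 \<le> Lip_const \<phi>"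
proof -
  obtain C where C: "0 \<le> C" "\<And>x y. \<bar>\<phi> x - \<phi> y\<bar> \<le> C * dist x y"
    using LipE[OF assms] by blast
  have "bdd_above (range (\<lambda>(x, y). \<bar>\<phi> x - \<phi> y\<bar> / dist x y))"
    using C by (intro bdd_aboveI[of _ C]) (auto simp: divide_le_eq)
  from cSUP_upper[OF _ this, of "(undefined, undefined)"]
  show ?thesis by (simp add: Lip_const_def)
qed

lemma Lip_const_cong:
  assumes "\<And>x. \<phi> x = \<psi> x + c"
  shows "Lip_const \<phi> = Lip_const \<psi>"
  using assms by (simp add: Lip_const_def)

lemma Lip_0: "(\<lambda>x. c) \<in> Lip"
  by (rule LipI[of _ 0]) simp

lemma Lip_scale_bound:
  assumes "\<phi> \<in> Lip"
  shows "\<bar>c * \<phi> x - c * \<phi> y\<bar> \<le> \<bar>c\<bar> * Lip_const \<phi> * dist x y"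
  using mult_left_mono[OF Lip_const_bound[OF assms, of x y], of "\<bar>c\<bar>"]
  by (simp add: abs_mult[symmetric] right_diff_distrib mult.assoc)

lemma Lip_scale: "\<phi> \<in> Lip \<Longrightarrow> (\<lambda>x. c * \<phi> x) \<in> Lip"
  by (rule LipI[OF Lip_scale_bound])

lemma Lip_add_bound:
  assumes "\<phi> \<in> Lip" "\<psi> \<in> Lip"
  shows "\<bar>(\<phi> x + \<psi> x) - (\<phi> y + \<psi> y)\<bar> \<le> (Lip_const \<phi> + Lip_const \<psi>) * dist x y"
  using Lip_const_bound[OF assms(1), of x y] Lip_const_bound[OF assms(2), of x y]
  by (simp add: distrib_right)

lemma Lip_add: "\<phi> \<in> Lip \<Longrightarrow> \<psi> \<in> Lip \<Longrightarrow> (\<lambda>x. \<phi> x + \<psi> x) \<in> Lip"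
  by (rule LipI[OF Lip_add_bound])

lemma Lip_uminus: "\<phi> \<in> Lip \<Longrightarrow> (\<lambda>x. - \<phi> x) \<in> Lip"
  using Lip_scale[of \<phi> "-1"] by simp

lemma Lip_diff: "\<phi> \<in> Lip \<Longrightarrow> \<psi> \<in> Lip \<Longrightarrow> (\<lambda>x. \<phi> x - \<psi> x) \<in> Lip"
  using Lip_add[OF _ Lip_uminus, of \<phi> \<psi>] by simp

definition Lip_rel :: "('x::metric_space \<Rightarrow> real) \<Rightarrow> ('x \<Rightarrow> real) \<Rightarrow> bool" where
  "Lip_rel \<phi> \<psi> \<longleftrightarrow> \<phi> \<in> Lip \<and> \<psi> \<in> Lip \<and> (\<exists>c. \<forall>x. \<phi> x = \<psi> x + c)"

lemma Lip_relI:
  "\<phi> \<in> Lip \<Longrightarrow> \<psi> \<in> Lip \<Longrightarrow> (\<And>x. \<phi> x = \<psi> x + c) \<Longrightarrow> Lip_rel \<phi> \<psi>"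
  unfolding Lip_rel_def by blast

lemma Lip_relE:
  assumes "Lip_rel \<phi> \<psi>"
  obtains c where "\<phi> \<in> Lip" "\<psi> \<in> Lip" "\<And>x. \<phi> x = \<psi> x + c"
  using assms unfolding Lip_rel_def by blast

quotient_type (overloaded) 'x Lip_mod = "'x::metric_space \<Rightarrow> real" / partial: Lip_rel
proof (rule part_equivpI)
  show "\<exists>\<phi>::'x \<Rightarrow> real. Lip_rel \<phi> \<phi>"
    using Lip_0[of 0] by (auto simp: Lip_rel_def)
  show "symp (Lip_rel :: ('x \<Rightarrow> real) \<Rightarrow> _)"
  proof (rule sympI)
    fix \<phi> \<psi> :: "'x \<Rightarrow> real" assume "Lip_rel \<phi> \<psi>"
    then obtain c where "\<phi> \<in> Lip" "\<psi> \<in> Lip" "\<forall>x. \<phi> x = \<psi> x + c"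
      by (auto simp: Lip_rel_def)
    then show "Lip_rel \<psi> \<phi>"
      by (auto simp: Lip_rel_def intro!: exI[of _ "- c"])
  qed
  show "transp (Lip_rel :: ('x \<Rightarrow> real) \<Rightarrow> _)"
  proof (rule transpI)
    fix \<phi> \<psi> \<theta> :: "'x \<Rightarrow> real" assume "Lip_rel \<phi> \<psi>" "Lip_rel \<psi> \<theta>"
    then obtain c d where "\<phi> \<in> Lip" "\<theta> \<in> Lip" "\<forall>x. \<phi> x = \<psi> x + c" "\<forall>x. \<psi> x = \<theta> x + d"
      by (auto simp: Lip_rel_def)
    then show "Lip_rel \<phi> \<theta>"
      by (auto simp: Lip_rel_def intro!: exI[of _ "d + c"])
  qed
qed

instantiation Lip_mod :: (metric_space) real_vector
begin

lift_definition zero_Lip_mod :: "'a Lip_mod" is "\<lambda>x. 0"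
  by (simp add: Lip_rel_def Lip_0)

lift_definition plus_Lip_mod :: "'a Lip_mod \<Rightarrow> 'a Lip_mod \<Rightarrow> 'a Lip_mod"
  is "\<lambda>\<phi> \<psi> x. \<phi> x + \<psi> x"
proof -
  fix \<phi> \<phi>' \<psi> \<psi>' :: "'a \<Rightarrow> real" assume a: "Lip_rel \<phi> \<phi>'" "Lip_rel \<psi> \<psi>'"
  obtain c where c: "\<phi> \<in> Lip" "\<phi>' \<in> Lip" "\<And>x. \<phi> x = \<phi>' x + c" using Lip_relE[OF a(1)] by blast
  obtain d where d: "\<psi> \<in> Lip" "\<psi>' \<in> Lip" "\<And>x. \<psi> x = \<psi>' x + d" using Lip_relE[OF a(2)] by blast
  show "Lip_rel (\<lambda>x. \<phi> x + \<psi> x) (\<lambda>x. \<phi>' x + \<psi>' x)"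
    by (rule Lip_relI[of _ _ "c + d", OF Lip_add[OF c(1) d(1)] Lip_add[OF c(2) d(2)]]) (simp add: c(3) d(3))
qed

lift_definition minus_Lip_mod :: "'a Lip_mod \<Rightarrow> 'a Lip_mod \<Rightarrow> 'a Lip_mod"
  is "\<lambda>\<phi> \<psi> x. \<phi> x - \<psi> x"
proof -
  fix \<phi> \<phi>' \<psi> \<psi>' :: "'a \<Rightarrow> real" assume a: "Lip_rel \<phi> \<phi>'" "Lip_rel \<psi> \<psi>'"
  obtain c where c: "\<phi> \<in> Lip" "\<phi>' \<in> Lip" "\<And>x. \<phi> x = \<phi>' x + c" using Lip_relE[OF a(1)] by blast
  obtain d where d: "\<psi> \<in> Lip" "\<psi>' \<in> Lip" "\<And>x. \<psi> x = \<psi>' x + d" using Lip_relE[OF a(2)] by blast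
  show "Lip_rel (\<lambda>x. \<phi> x - \<psi> x) (\<lambda>x. \<phi>' x - \<psi>' x)"
    by (rule Lip_relI[of _ _ "c - d", OF Lip_diff[OF c(1) d(1)] Lip_diff[OF c(2) d(2)]]) (simp add: c(3) d(3))
qed

lift_definition uminus_Lip_mod :: "'a Lip_mod \<Rightarrow> 'a Lip_mod"
  is "\<lambda>\<phi> x. - \<phi> x"
proof -
  fix \<phi> \<phi>' :: "'a \<Rightarrow> real" assume a: "Lip_rel \<phi> \<phi>'"
  obtain c where c: "\<phi> \<in> Lip" "\<phi>' \<in> Lip" "\<And>x. \<phi> x = \<phi>' x + c" using Lip_relE[OF a] by blast
  show "Lip_rel (\<lambda>x. - \<phi> x) (\<lambda>x. - \<phi>' x)"
    by (rule Lip_relI[of _ _ "- c", OF Lip_uminus[OF c(1)] Lip_uminus[OF c(2)]]) (simp add: c(3) distrib_left)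
qed

lift_definition scaleR_Lip_mod :: "real \<Rightarrow> 'a Lip_mod \<Rightarrow> 'a Lip_mod"
  is "\<lambda>r \<phi> x. r * \<phi> x"
proof -
  fix r :: real and \<phi> \<phi>' :: "'a \<Rightarrow> real" assume a: "Lip_rel \<phi> \<phi>'"
  obtain c where c: "\<phi> \<in> Lip" "\<phi>' \<in> Lip" "\<And>x. \<phi> x = \<phi>' x + c" using Lip_relE[OF a] by blast
  show "Lip_rel (\<lambda>x. r * \<phi> x) (\<lambda>x. r * \<phi>' x)"
    by (rule Lip_relI[of _ _ "r * c", OF Lip_scale[OF c(1)] Lip_scale[OF c(2)]]) (simp add: c(3) distrib_left)
qed

instance
proof
  fix \<Phi> \<Psi> \<Theta> :: "'a Lip_mod" and r s :: real
  show "\<Phi> + \<Psi> + \<Theta> = \<Phi> + (\<Psi> + \<Theta>)"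
    by transfer (auto simp: Lip_rel_def add.assoc intro!: Lip_add)
  show "\<Phi> + \<Psi> = \<Psi> + \<Phi>"
    by transfer (auto simp: Lip_rel_def intro!: Lip_add)
  show "0 + \<Phi> = \<Phi>"
    by transfer (auto simp: Lip_rel_def)
  show "- \<Phi> + \<Phi> = 0"
    by transfer (auto simp: Lip_rel_def Lip_0)
  show "\<Phi> - \<Psi> = \<Phi> + - \<Psi>"
    by transfer (auto simp: Lip_rel_def intro!: Lip_diff)
  show "r *\<^sub>R (\<Phi> + \<Psi>) = r *\<^sub>R \<Phi> + r *\<^sub>R \<Psi>"
    by transfer (auto simp: Lip_rel_def distrib_left intro!: Lip_add Lip_scale)
  show "(r + s) *\<^sub>R \<Phi> = r *\<^sub>R \<Phi> + s *\<^sub>R \<Phi>"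
    by transfer (auto simp: Lip_rel_def distrib_right intro!: Lip_add Lip_scale)
  show "r *\<^sub>R s *\<^sub>R \<Phi> = (r * s) *\<^sub>R \<Phi>"
    by transfer (auto simp: Lip_rel_def mult.assoc intro: Lip_scale[of _ "_ * _", simplified mult.assoc])
  show "1 *\<^sub>R \<Phi> = \<Phi>"
    by transfer (auto simp: Lip_rel_def)
qed

end

instantiation Lip_mod :: (metric_space) real_normed_vector
begin

lift_definition norm_Lip_mod :: "'a Lip_mod \<Rightarrow> real" is Lip_const
  by (auto simp: Lip_rel_def intro: Lip_const_cong)

definition dist_Lip_mod :: "'a Lip_mod \<Rightarrow> 'a Lip_mod \<Rightarrow> real" where
  "dist_Lip_mod \<Phi> \<Psi> = norm (\<Phi> - \<Psi>)"

definition sgn_Lip_mod :: "'a Lip_mod \<Rightarrow> 'a Lip_mod" where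
  "sgn_Lip_mod \<Phi> = \<Phi> /\<^sub>R norm \<Phi>"

definition uniformity_Lip_mod :: "('a Lip_mod \<times> 'a Lip_mod) filter" where
  "uniformity_Lip_mod = (INF e\<in>{0<..}. principal {(x, y). dist x y < e})"

definition open_Lip_mod :: "'a Lip_mod set \<Rightarrow> bool" where
  "open_Lip_mod U \<longleftrightarrow> (\<forall>x\<in>U. \<forall>\<^sub>F (x', y) in uniformity. x' = x \<longrightarrow> y \<in> U)"

instance
proof
  fix \<Phi> \<Psi> :: "'a Lip_mod" and r :: real
  show "dist \<Phi> \<Psi> = norm (\<Phi> - \<Psi>)"
    by (rule dist_Lip_mod_def)
  show "sgn \<Phi> = \<Phi> /\<^sub>R norm \<Phi>"
    by (rule sgn_Lip_mod_def)
  show "uniformity = (INF e\<in>{0<..}. principal {(x, y). dist (x::'a Lip_mod) y < e})"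
    by (rule uniformity_Lip_mod_def)
  show "open U \<longleftrightarrow> (\<forall>x\<in>U. \<forall>\<^sub>F (x', y) in uniformity. x' = x \<longrightarrow> y \<in> U)"
    for U :: "'a Lip_mod set"
    by (rule open_Lip_mod_def)
  show "norm \<Phi> = 0 \<longleftrightarrow> \<Phi> = 0"
  proof (transfer, rule iffI)
    fix \<phi> :: "'a \<Rightarrow> real" assume a: "Lip_rel \<phi> \<phi>" "Lip_const \<phi> = 0"
    then have "\<phi> x = \<phi> undefined" for x
      using Lip_const_bound[of \<phi> x undefined] by (simp add: Lip_rel_def)
    with a show "Lip_rel \<phi> (\<lambda>x. 0)"
      by (auto simp: Lip_rel_def Lip_0)
  next
    fix \<phi> :: "'a \<Rightarrow> real" assume "Lip_rel \<phi> (\<lambda>x. 0)"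
    then obtain c where "\<And>x. \<phi> x = c" by (auto simp: Lip_rel_def)
    then show "Lip_const \<phi> = 0" by (simp add: Lip_const_def case_prod_beta)
  qed
  show "norm (\<Phi> + \<Psi>) \<le> norm \<Phi> + norm \<Psi>"
    by transfer (auto simp: Lip_rel_def intro!: Lip_const_least Lip_add_bound add_nonneg_nonneg Lip_const_nonneg)
  show "norm (r *\<^sub>R \<Phi>) = \<bar>r\<bar> * norm \<Phi>"
  proof (transfer, rule antisym)
    fix r and \<phi> :: "'a \<Rightarrow> real" assume "Lip_rel \<phi> \<phi>"
    then have \<phi>: "\<phi> \<in> Lip" by (simp add: Lip_rel_def)
    have le: "Lip_const (\<lambda>x. t * \<psi> x) \<le> \<bar>t\<bar> * Lip_const \<psi>" if "\<psi> \<in> Lip" for t and \<psi> :: "'a \<Rightarrow> real"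
      using that by (intro Lip_const_least Lip_scale_bound mult_nonneg_nonneg Lip_const_nonneg) auto
    show "Lip_const (\<lambda>x. r * \<phi> x) \<le> \<bar>r\<bar> * Lip_const \<phi>" using le[OF \<phi>] .
    show "\<bar>r\<bar> * Lip_const \<phi> \<le> Lip_const (\<lambda>x. r * \<phi> x)"
    proof (cases "r = 0")
      case True
      then show ?thesis using Lip_const_nonneg[OF Lip_scale[OF \<phi>, of r]] by simp
    next
      case False
      then show ?thesis
        using le[OF Lip_scale[OF \<phi>, of r], of "inverse r"]
        by (simp add: mult.assoc[symmetric] abs_inverse field_simps)
    qed
  qed
qed

end

instance Lip_mod :: (metric_space) banach
proof
  fix F :: "nat \<Rightarrow> 'a Lip_mod" assume F: "Cauchy F"
  define x0 :: 'a where "x0 = undefined"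
  have "\<exists>\<phi>. \<phi> \<in> Lip \<and> \<phi> x0 = 0 \<and> abs_Lip_mod \<phi> = F n" for n
  proof -
    obtain \<psi> where \<psi>: "Lip_rel \<psi> \<psi>" "abs_Lip_mod \<psi> = F n"
      by (metis Quotient3_Lip_mod Quotient3_rep_reflp Quotient3_abs_rep)
    let ?\<phi> = "\<lambda>x. \<psi> x - \<psi> x0"
    have "Lip_rel ?\<phi> \<psi>"
      using \<psi>(1) by (auto simp: Lip_rel_def intro!: Lip_diff Lip_0 exI[of _ "- \<psi> x0"])
    then have "abs_Lip_mod ?\<phi> = F n"
      using \<psi> by (metis Quotient3_Lip_mod Quotient3_rel)
    with \<open>Lip_rel ?\<phi> \<psi>\<close> show ?thesis
      by (intro exI[of _ ?\<phi>]) (auto simp: Lip_rel_def)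
  qed
  then obtain f where f: "\<And>n. f n \<in> Lip" "\<And>n. f n x0 = 0" "\<And>n. abs_Lip_mod (f n) = F n"
    by metis
  have rel: "Lip_rel \<phi> \<phi>" if "\<phi> \<in> Lip" for \<phi> :: "'a \<Rightarrow> real"
    using that by (auto simp: Lip_rel_def)
  have dist_eq: "dist (abs_Lip_mod \<phi>) (abs_Lip_mod \<psi>) = Lip_const (\<lambda>x. \<phi> x - \<psi> x)"
    if "\<phi> \<in> Lip" "\<psi> \<in> Lip" for \<phi> \<psi> :: "'a \<Rightarrow> real"
    using that
    by (simp add: dist_Lip_mod_def minus_Lip_mod.abs_eq norm_Lip_mod.abs_eq rel Lip_diff)
  have diff: "\<bar>(f m x - f n x) - (f m y - f n y)\<bar> \<le> dist (F m) (F n) * dist x y" for m n x y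
    using Lip_const_bound[OF Lip_diff[OF f(1)[of m] f(1)[of n]], of x y] dist_eq[OF f(1)[of m] f(1)[of n]]
    by (simp add: f(3))
  have "Cauchy (\<lambda>n. f n x)" for x
  proof (rule metric_CauchyI)
    fix e :: real assume "0 < e"
    then have "0 < e / (1 + dist x x0)" by (simp add: add_pos_nonneg)
    then obtain N where N: "\<forall>m\<ge>N. \<forall>n\<ge>N. dist (F m) (F n) < e / (1 + dist x x0)"
      using F unfolding Cauchy_def by blast
    have "dist (f m x) (f n x) < e" if "N \<le> m" "N \<le> n" for m n
    proof -
      have pos: "0 < 1 + dist x x0" by (simp add: add_pos_nonneg)
      have "dist (f m x) (f n x) \<le> dist (F m) (F n) * dist x x0"
        using diff[of m x n x0] f(2) by (simp add: dist_real_def)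
      also have "\<dots> \<le> dist (F m) (F n) * (1 + dist x x0)"
        by (intro mult_left_mono) auto
      also have "\<dots> < e"
        using N that pos by (simp add: pos_less_divide_eq)
      finally show ?thesis .
    qed
    then show "\<exists>N. \<forall>m\<ge>N. \<forall>n\<ge>N. dist (f m x) (f n x) < e" by blast
  qed
  then have "\<exists>l. (\<lambda>n. f n x) \<longlonglongrightarrow> l" for x
    using Cauchy_convergent_iff convergent_def by metis
  then obtain l where l: "\<And>x. (\<lambda>n. f n x) \<longlonglongrightarrow> l x"
    by metis
  have tail: "\<bar>(f m x - l x) - (f m y - l y)\<bar> \<le> e * dist x y"
    if "\<forall>n\<ge>N. dist (F m) (F n) \<le> e" for e m N x y
  proof (rule LIMSEQ_le_const2)
    show "(\<lambda>n. \<bar>(f m x - f n x) - (f m y - f n y)\<bar>) \<longlonglongrightarrow> \<bar>(f m x - l x) - (f m y - l y)\<bar>"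
      by (intro tendsto_intros l)
    have "\<bar>(f m x - f n x) - (f m y - f n y)\<bar> \<le> e * dist x y" if "N \<le> n" for n
      using order_trans[OF diff mult_right_mono] that \<open>\<forall>n\<ge>N. _\<close> by simp
    then show "\<exists>N. \<forall>n\<ge>N. \<bar>(f m x - f n x) - (f m y - f n y)\<bar> \<le> e * dist x y" by blast
  qed
  obtain N where N: "\<forall>m\<ge>N. \<forall>n\<ge>N. dist (F m) (F n) < 1"
    using F unfolding Cauchy_def using zero_less_one by blast
  have "\<forall>n\<ge>N. dist (F N) (F n) \<le> 1" using N by (simp add: less_imp_le)
  from LipI[OF tail[OF this]] have "(\<lambda>x. f N x - l x) \<in> Lip" .
  from Lip_diff[OF f(1)[of N] this] have lLip: "l \<in> Lip" by simp
  have "F \<longlonglongrightarrow> abs_Lip_mod l"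
  proof (rule metric_LIMSEQ_I)
    fix e :: real assume e: "0 < e"
    then have "0 < e / 2" by simp
    then obtain N where N: "\<forall>m\<ge>N. \<forall>n\<ge>N. dist (F m) (F n) < e / 2"
      using F unfolding Cauchy_def by blast
    have "dist (F m) (abs_Lip_mod l) < e" if "N \<le> m" for m
    proof -
      have "\<forall>n\<ge>N. dist (F m) (F n) \<le> e / 2" using N that by (simp add: less_imp_le)
      from Lip_const_least[OF _ tail[OF this]] e
      have "Lip_const (\<lambda>x. f m x - l x) \<le> e / 2" by simp
      then show ?thesis
        using dist_eq[OF f(1)[of m] lLip] e by (simp add: f(3))
    qed
    then show "\<exists>N. \<forall>m\<ge>N. dist (F m) (abs_Lip_mod l) < e" by blast
  qed
  then show "convergent F" by (auto simp: convergent_def)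
qed

lift_definition constant_on_orbits ::
    "('g \<Rightarrow> 'x \<Rightarrow> 'x) \<Rightarrow> 'x::metric_space Lip_mod \<Rightarrow> bool"
  is "\<lambda>act \<phi>. \<forall>x. \<phi> constant_on action_orbit act x"
proof -
  fix act :: "'g \<Rightarrow> 'x \<Rightarrow> 'x" and \<phi> \<psi> :: "'x \<Rightarrow> real"
  assume "Lip_rel \<phi> \<psi>"
  then obtain c where c: "\<And>x. \<phi> x = \<psi> x + c" by (auto simp: Lip_rel_def)
  have "\<phi> constant_on A \<longleftrightarrow> \<psi> constant_on A" for A
    unfolding constant_on_def c by (metis add_diff_cancel_right')
  then show "(\<forall>x. \<phi> constant_on action_orbit act x) = (\<forall>x. \<psi> constant_on action_orbit act x)"
    by simp
qed

definition complemented :: "'v::real_normed_vector set \<Rightarrow> bool" where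
  "complemented V \<longleftrightarrow> subspace V \<and> closed V \<and>
     (\<exists>P :: 'v \<Rightarrow> 'v. bounded_linear P \<and> P \<circ> P = P \<and> range P = V)"

end

theory Submission
  imports Defs
begin

text \<open>
  For a Lipschitz function \<open>\<phi>\<close> the increments \<open>g \<mapsto> \<phi>(g x) - \<phi>(g y)\<close> are bounded, because the
  action is isometric, and belong to \<open>LUCB\<close>. Averaging them with an invariant mean gives a norm-one
  projection of the Lipschitz functions modulo constants onto the subspace \<open>A\<close> of those whose
  increments are invariant under \<open>G\<close>. For \<open>\<Phi>\<close> in \<open>A\<close>, the map \<open>g \<mapsto> \<phi>(g x) - \<phi>(x)\<close> is a continuous
  homomorphism that does not depend on \<open>x\<close>, and it vanishes exactly if \<open>\<phi>\<close> is constant on orbits.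
  As there are only finitely many independent homomorphisms, the orbit-constant functions are cut
  out of \<open>A\<close> by finitely many point evaluations \<open>\<phi>(g x) - \<phi>(x)\<close>. These are bounded functionals, and
  passing to the kernel of one of them preserves complementedness.
\<close>

section \<open>Complemented subspaces\<close>

text \<open>The range of an idempotent is its set of fixed points, which is closed because
  \<open>P\<close> is continuous.\<close>

lemma complementedI:
  assumes P: "bounded_linear P" and idem: "\<And>v. P (P v) = P v" and "range P = V"
  shows "complemented V"
proof -
  interpret bounded_linear P by (rule P)
  have "V = {v. P v = v}"
    unfolding assms(3)[symmetric] using idem by (auto intro: range_eqI[OF sym])
  moreover have "closed {v. P v = v}"
    by (intro closed_Collect_eq linear_continuous_on P continuous_on_id)
  moreover have "subspace {v. P v = v}"
    by (auto simp: subspace_def add scaleR zero)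
  ultimately show ?thesis
    using assms by (auto simp: complemented_def fun_eq_iff)
qed

text \<open>If \<open>P\<close> projects onto \<open>A\<close>, subtracting \<open>e (P v)\<close>
  times \<open>u\<close> from \<open>P v\<close> kills \<open>e\<close> without leaving
  \<open>A\<close>, and changes nothing where \<open>e\<close> already vanishes.\<close>

lemma complemented_Int_kernel:
  fixes e :: "'v::real_normed_vector \<Rightarrow> real"
  assumes "complemented A" and e: "bounded_linear e" and u: "u \<in> A" "e u = 1"
  shows "complemented {v \<in> A. e v = 0}"
proof -
  obtain P where P: "bounded_linear P" "P \<circ> P = P" "range P = A" and A: "subspace A"
    using assms(1) by (auto simp: complemented_def)
  interpret P: bounded_linear P by (rule P)
  interpret e: bounded_linear e by (rule e)
  have fix_P: "P v = v" if "v \<in> A" for v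
    using that P(2,3) by (auto simp: fun_eq_iff)
  have in_A: "P v \<in> A" for v
    using P(3) by blast
  let ?Q = "\<lambda>v. P v - e (P v) *\<^sub>R u"
  have Q_in: "?Q v \<in> {v \<in> A. e v = 0}" for v
    using A u in_A by (simp add: subspace_diff subspace_scale e.diff e.scaleR)
  have Q_fix: "?Q v = v" if "v \<in> {v \<in> A. e v = 0}" for v
    using that fix_P by simp
  show ?thesis
  proof (rule complementedI[of ?Q])
    show "bounded_linear ?Q"
      by (intro bounded_linear_sub P(1) bounded_linear_scaleR_const bounded_linear_compose[OF e P(1)])
    show "?Q (?Q v) = ?Q v" for v
      by (rule Q_fix[OF Q_in])
    show "range ?Q = {v \<in> A. e v = 0}"
    proof (intro subset_antisym subsetI)
      fix v assume "v \<in> range ?Q"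
      then obtain w where "v = ?Q w" by blast
      then show "v \<in> {v \<in> A. e v = 0}" using Q_in[of w] by simp
    next
      fix v assume "v \<in> {v \<in> A. e v = 0}"
      then have "v = ?Q v" using Q_fix[of v] by simp
      then show "v \<in> range ?Q" by (rule range_eqI)
    qed
  qed
qed

text \<open>Induction on the number of functions \<open>f i\<close>: if some \<open>e g0\<close> is
  nonzero on \<open>A\<close>, passing to its kernel saves one function; once none is left, every
  \<open>e g\<close> vanishes on \<open>A\<close>.\<close>

lemma complemented_common_kernel:
  fixes e :: "'g \<Rightarrow> 'v::real_normed_vector \<Rightarrow> real" and f :: "'i \<Rightarrow> 'g \<Rightarrow> real"
  assumes "finite I" "complemented A" "\<And>g. bounded_linear (e g)"
    and "\<And>v. v \<in> A \<Longrightarrow> \<exists>c. \<forall>g. e g v = (\<Sum>i\<in>I. c i * f i g)"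
  shows "complemented {v \<in> A. \<forall>g. e g v = 0}"
  using assms
proof (induction "card I" arbitrary: I A f)
  case 0
  then have "{v \<in> A. \<forall>g. e g v = 0} = A" by auto
  with 0 show ?case by simp
next
  case (Suc n)
  show ?case
  proof (cases "\<forall>v\<in>A. \<forall>g. e g v = 0")
    case True
    then have "{v \<in> A. \<forall>g. e g v = 0} = A" by auto
    with Suc show ?thesis by simp
  next
    case False
    then obtain w g0 where w: "w \<in> A" "e g0 w \<noteq> 0" by blast
    have A: "subspace A"
      using Suc.prems(2) by (simp add: complemented_def)
    define u where "u = (1 / e g0 w) *\<^sub>R w"
    have u: "u \<in> A" "e g0 u = 1"
      using w A Suc.prems(3) by (auto simp: u_def subspace_scale bounded_linear.linear linear_cmul)
    obtain c where c: "\<And>g. e g u = (\<Sum>i\<in>I. c i * f i g)"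
      using Suc.prems(4)[OF u(1)] by blast
    \<comment> \<open>A nonzero coefficient lets \<open>f j\<close> be expressed through
      \<open>\<lambda>g. e g u\<close> and the other \<open>f i\<close>.\<close>
    have "\<exists>j\<in>I. c j \<noteq> 0"
    proof (rule ccontr)
      assume "\<not> ?thesis"
      then have "e g0 u = 0" by (simp add: c)
      with u show False by simp
    qed
    then obtain j where j: "j \<in> I" "c j \<noteq> 0" by blast
    have split: "(\<Sum>i\<in>I. d i) = d j + (\<Sum>i\<in>I - {j}. d i)" for d :: "'i \<Rightarrow> real"
      using j(1) Suc.prems(1) by (simp add: sum.remove)
    let ?A = "{v \<in> A. e g0 v = 0}"
    \<comment> \<open>The multiple of \<open>e g u\<close> is chosen so that each new function
      vanishes at \<open>g0\<close>, as \<open>\<lambda>g. e g v\<close> does for \<open>v\<close>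
      in \<open>?A\<close>.\<close>
    let ?f = "\<lambda>i g. f i g - f i g0 * e g u"
    have "complemented {v \<in> ?A. \<forall>g. e g v = 0}"
    proof (rule Suc.hyps(1)[of "I - {j}" _ ?f])
      show "n = card (I - {j})" using Suc.hyps(2) j(1) by simp
      show "finite (I - {j})" using Suc.prems(1) by simp
      show "complemented ?A"
        by (rule complemented_Int_kernel[OF Suc.prems(2,3) u])
      show "bounded_linear (e g)" for g by (rule Suc.prems(3))
      fix v assume v: "v \<in> ?A"
      then obtain d where d: "\<And>g. e g v = (\<Sum>i\<in>I. d i * f i g)"
        using Suc.prems(4)[of v] by blast
      define b where "b i = d i - d j / c j * c i" for i
      \<comment> \<open>Trading \<open>f j\<close> for \<open>\<lambda>g. e g u\<close> in the expansion of \<open>v\<close>.\<close>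
      have *: "e g v = (\<Sum>i\<in>I - {j}. b i * f i g) + d j / c j * e g u" for g
      proof -
        have "e g v - d j / c j * e g u = (\<Sum>i\<in>I. b i * f i g)"
          unfolding c d b_def by (simp add: sum_distrib_left sum_subtractf algebra_simps)
        also have "\<dots> = (\<Sum>i\<in>I - {j}. b i * f i g)"
          using j(2) by (subst split) (simp add: b_def)
        finally show ?thesis by simp
      qed
      \<comment> \<open>Evaluation at \<open>g0\<close>, where \<open>v\<close> gives 0 and
        \<open>u\<close> gives 1, determines the coefficient of \<open>e g u\<close>.\<close>
      have coeff: "d j / c j = - (\<Sum>i\<in>I - {j}. b i * f i g0)"
        using v *[of g0] u(2) by simp
      have "e g v = (\<Sum>i\<in>I - {j}. b i * ?f i g)" for g
        unfolding *[of g] coeff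
        by (simp add: sum_distrib_left sum_distrib_right sum_subtractf algebra_simps)
      then show "\<exists>c. \<forall>g. e g v = (\<Sum>i\<in>I - {j}. c i * ?f i g)" by blast
    qed
    moreover have "{v \<in> ?A. \<forall>g. e g v = 0} = {v \<in> A. \<forall>g. e g v = 0}" by auto
    ultimately show ?thesis by simp
  qed
qed

section \<open>Increments of Lipschitz functions\<close>

text \<open>Point values make no sense modulo constants, but differences of values do, and they
  determine both the class and its norm.\<close>

lift_definition increment :: "'x::metric_space \<Rightarrow> 'x \<Rightarrow> 'x Lip_mod \<Rightarrow> real"
  is "\<lambda>x y \<phi>. \<phi> x - \<phi> y"
  by (auto simp: Lip_rel_def)

lemma increment_abs: "\<phi> \<in> Lip \<Longrightarrow> increment x y (abs_Lip_mod \<phi>) = \<phi> x - \<phi> y"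
  by (simp add: increment.abs_eq Lip_rel_def)

lemma increment_trans: "increment x y \<Phi> + increment y z \<Phi> = increment x z \<Phi>"
  by transfer simp

lemma increment_add: "increment x y (\<Phi> + \<Psi>) = increment x y \<Phi> + increment x y \<Psi>"
  by transfer simp

lemma increment_scaleR: "increment x y (r *\<^sub>R \<Phi>) = r * increment x y \<Phi>"
  by transfer (simp add: algebra_simps)

lemma increment_bound: "\<bar>increment x y \<Phi>\<bar> \<le> norm \<Phi> * dist x y"
  by transfer (simp add: Lip_rel_def Lip_const_bound)

lemma norm_le_increment:
  assumes "0 \<le> C" "\<And>x y. \<bar>increment x y \<Phi>\<bar> \<le> C * dist x y"
  shows "norm \<Phi> \<le> C"
  using assms by transfer (rule Lip_const_least)

lemma Lip_mod_eqI:
  assumes "\<And>x y. increment x y \<Phi> = increment x y \<Psi>"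
  shows "\<Phi> = \<Psi>"
  using assms
proof transfer
  fix \<phi> \<psi> :: "'a \<Rightarrow> real"
  assume "Lip_rel \<phi> \<phi>" "Lip_rel \<psi> \<psi>" and eq: "\<And>x y. \<phi> x - \<phi> y = \<psi> x - \<psi> y"
  moreover have "\<phi> x = \<psi> x + (\<phi> undefined - \<psi> undefined)" for x
    using eq[of x undefined] by simp
  ultimately show "Lip_rel \<phi> \<psi>"
    unfolding Lip_rel_def by blast
qed

lemma bounded_linear_increment: "bounded_linear (increment x y)"
proof (rule bounded_linear_intro)
  show "norm (increment x y \<Phi>) \<le> norm \<Phi> * dist x y" for \<Phi>
    using increment_bound by simp
qed (simp_all add: increment_add increment_scaleR)

text \<open>The orbit of \<open>x\<close> contains \<open>x = act 0 x\<close>, so constancy on it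
  can be tested against the value at \<open>x\<close>.\<close>

lemma constant_on_orbits_iff:
  fixes act :: "'g::zero \<Rightarrow> 'x::metric_space \<Rightarrow> 'x"
  assumes "\<And>x. act 0 x = x"
  shows "constant_on_orbits act \<Phi> \<longleftrightarrow> (\<forall>g x. increment (act g x) x \<Phi> = 0)"
  using assms
proof transfer
  fix act :: "'g \<Rightarrow> 'x \<Rightarrow> 'x" and \<phi> :: "'x \<Rightarrow> real"
  assume act: "\<And>x. act 0 x = x"
  show "(\<forall>x. \<phi> constant_on action_orbit act x) \<longleftrightarrow> (\<forall>g x. \<phi> (act g x) - \<phi> x = 0)"
    unfolding constant_on_def action_orbit_def
    by (simp) (metis act)
qed

section \<open>Averaging over the group\<close>

lemma const_in_LUCB: "(\<lambda>_. c) \<in> LUCB"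
  by (auto simp: LUCB_def intro: uniform_limitI)

lemma
  assumes "mean_on_LUCB m" "\<phi> \<in> LUCB"
  shows mean_add: "\<psi> \<in> LUCB \<Longrightarrow> m (\<lambda>x. \<phi> x + \<psi> x) = m \<phi> + m \<psi>"
    and mean_scale: "m (\<lambda>x. c * \<phi> x) = c * m \<phi>"
    and mean_abs_le: "\<bar>m \<phi>\<bar> \<le> (SUP x. \<bar>\<phi> x\<bar>)"
  using assms by (simp_all add: mean_on_LUCB_def)

lemma mean_const:
  assumes "mean_on_LUCB m"
  shows "m (\<lambda>_. c) = c"
  using mean_scale[OF assms const_in_LUCB, of c 1] assms by (simp add: mean_on_LUCB_def)

lemma continuous_orbit_map:
  assumes "continuous_isometric_action act"
  shows "continuous_on UNIV (\<lambda>g. act g x)"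
proof -
  have "continuous_on UNIV ((\<lambda>(g, x). act g x) \<circ> (\<lambda>g. (g, x)))"
    using assms
    by (intro continuous_on_compose continuous_intros)
      (auto simp: continuous_isometric_action_def intro: continuous_on_subset)
  then show ?thesis by (simp add: o_def)
qed

text \<open>Since \<open>act k\<close> is an isometry, replacing \<open>g\<close> by
  \<open>h\<close> in the right translate costs at most \<open>norm \<Phi>\<close> times the
  distances from \<open>act h x\<close> to \<open>act g x\<close> and from \<open>act h y\<close> to
  \<open>act g y\<close>, uniformly in \<open>k\<close>.\<close>

lemma increment_in_LUCB:
  fixes act :: "'g::topological_group_add \<Rightarrow> 'x::metric_space \<Rightarrow> 'x"
  assumes act: "continuous_isometric_action act"
  shows "(\<lambda>g. increment (act g x) (act g y) \<Phi>) \<in> LUCB"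
proof -
  have mult: "act (g + h) z = act g (act h z)" and isom: "dist (act g z) (act g z') = dist z z'"
    for g h z z'
    using act by (auto simp: continuous_isometric_action_def)
  have "bounded (range (\<lambda>g. increment (act g x) (act g y) \<Phi>))"
    using increment_bound[of "act g x" "act g y" \<Phi> for g]
    by (auto simp: isom intro!: boundedI[of _ "norm \<Phi> * dist x y"])
  moreover have "uniform_limit UNIV (\<lambda>h k. increment (act (k + h) x) (act (k + h) y) \<Phi>)
      (\<lambda>k. increment (act (k + g) x) (act (k + g) y) \<Phi>) (nhds g)" for g
  proof (rule uniform_limitI)
    fix e :: real assume e: "0 < e"
    let ?B = "\<lambda>h. norm \<Phi> * (dist (act h x) (act g x) + dist (act h y) (act g y))"
    \<comment> \<open>Continuity gives the limit along the punctured filter \<open>at g\<close>;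
      \<open>LUCB\<close> needs it along \<open>nhds g\<close>.\<close>
    have lim: "((\<lambda>h. act h z) \<longlongrightarrow> act g z) (nhds g)" for z
      using continuous_orbit_map[OF act, of z] tendsto_at_iff_tendsto_nhds[of "\<lambda>h. act h z" g]
      by (simp add: continuous_on_def)
    have "(?B \<longlongrightarrow> norm \<Phi> * (dist (act g x) (act g x) + dist (act g y) (act g y))) (nhds g)"
      by (intro tendsto_intros lim)
    then have "\<forall>\<^sub>F h in nhds g. ?B h < e"
      using e by (auto dest: order_tendstoD(2))
    moreover have "dist (increment (act (k + h) x) (act (k + h) y) \<Phi>)
        (increment (act (k + g) x) (act (k + g) y) \<Phi>) \<le> ?B h" for h k
    proof -
      have "increment (act (k + h) x) (act (k + h) y) \<Phi> - increment (act (k + g) x) (act (k + g) y) \<Phi>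
          = increment (act (k + h) x) (act (k + g) x) \<Phi> - increment (act (k + h) y) (act (k + g) y) \<Phi>"
        by transfer simp
      then show ?thesis
        using increment_bound[of "act (k + h) x" "act (k + g) x" \<Phi>]
          increment_bound[of "act (k + h) y" "act (k + g) y" \<Phi>]
        by (simp add: dist_real_def mult isom distrib_left)
    qed
    ultimately show "\<forall>\<^sub>F h in nhds g. \<forall>k\<in>UNIV. dist (increment (act (k + h) x) (act (k + h) y) \<Phi>)
        (increment (act (k + g) x) (act (k + g) y) \<Phi>) < e"
      by (auto elim!: eventually_mono intro: le_less_trans)
  qed
  ultimately show ?thesis by (simp add: LUCB_def)
qed

text \<open>The values of a Lipschitz function along an orbit may be unbounded, so increments to a
  base point are averaged; for a mean and an isometric action another base point alters the result
  by a constant only.\<close>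

definition average ::
    "(('g \<Rightarrow> real) \<Rightarrow> real) \<Rightarrow> ('g \<Rightarrow> 'x \<Rightarrow> 'x) \<Rightarrow> 'x::metric_space Lip_mod \<Rightarrow> 'x Lip_mod" where
  "average m act \<Phi> = abs_Lip_mod (\<lambda>x. m (\<lambda>g. increment (act g x) (act g undefined) \<Phi>))"

lemma mean_increment_trans:
  assumes "mean_on_LUCB m" "continuous_isometric_action act"
  shows "m (\<lambda>g. increment (act g x) (act g y) \<Phi>) + m (\<lambda>g. increment (act g y) (act g z) \<Phi>)
    = m (\<lambda>g. increment (act g x) (act g z) \<Phi>)"
proof -
  have "m (\<lambda>g. increment (act g x) (act g y) \<Phi> + increment (act g y) (act g z) \<Phi>)
    = m (\<lambda>g. increment (act g x) (act g y) \<Phi>) + m (\<lambda>g. increment (act g y) (act g z) \<Phi>)"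
    by (intro mean_add increment_in_LUCB assms)
  then show ?thesis by (simp add: increment_trans)
qed

lemma mean_increment_bound:
  assumes m: "mean_on_LUCB m" and act: "continuous_isometric_action act"
  shows "\<bar>m (\<lambda>g. increment (act g x) (act g y) \<Phi>)\<bar> \<le> norm \<Phi> * dist x y"
proof -
  have "\<bar>m (\<lambda>g. increment (act g x) (act g y) \<Phi>)\<bar> \<le> (SUP g. \<bar>increment (act g x) (act g y) \<Phi>\<bar>)"
    by (rule mean_abs_le[OF m increment_in_LUCB[OF act]])
  also have "\<dots> \<le> norm \<Phi> * dist x y"
    using act increment_bound[of "act g x" "act g y" \<Phi> for g]
    by (intro cSUP_least) (auto simp: continuous_isometric_action_def)
  finally show ?thesis .
qed

text \<open>By additivity of the mean the base point cancels; the resulting bound also shows that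
  the averaged function is Lipschitz.\<close>

lemma increment_average:
  assumes "mean_on_LUCB m" "continuous_isometric_action act"
  shows "increment x y (average m act \<Phi>) = m (\<lambda>g. increment (act g x) (act g y) \<Phi>)"
proof -
  let ?\<phi> = "\<lambda>x. m (\<lambda>g. increment (act g x) (act g undefined) \<Phi>)"
  have diff: "?\<phi> x - ?\<phi> y = m (\<lambda>g. increment (act g x) (act g y) \<Phi>)" for x y
    using mean_increment_trans[OF assms, of x y \<Phi> undefined] by simp
  have "?\<phi> \<in> Lip"
    by (rule LipI[of _ "norm \<Phi>"]) (simp add: diff mean_increment_bound[OF assms])
  then show ?thesis
    by (simp add: average_def increment_abs diff)
qed

lemma bounded_linear_average:
  assumes m: "mean_on_LUCB m" and act: "continuous_isometric_action act"
  shows "bounded_linear (average m act)"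
proof (rule bounded_linear_intro)
  note LUCB = increment_in_LUCB[OF act]
  note incr = increment_average[OF m act]
  show "average m act (\<Phi> + \<Psi>) = average m act \<Phi> + average m act \<Psi>" for \<Phi> \<Psi>
  proof (rule Lip_mod_eqI)
    fix x y
    have "m (\<lambda>g. increment (act g x) (act g y) \<Phi> + increment (act g x) (act g y) \<Psi>)
      = m (\<lambda>g. increment (act g x) (act g y) \<Phi>) + m (\<lambda>g. increment (act g x) (act g y) \<Psi>)"
      by (intro mean_add m LUCB)
    then show "increment x y (average m act (\<Phi> + \<Psi>)) = increment x y (average m act \<Phi> + average m act \<Psi>)"
      by (simp add: incr increment_add)
  qed
  show "average m act (r *\<^sub>R \<Phi>) = r *\<^sub>R average m act \<Phi>" for r \<Phi>
  proof (rule Lip_mod_eqI)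
    fix x y
    have "m (\<lambda>g. r * increment (act g x) (act g y) \<Phi>) = r * m (\<lambda>g. increment (act g x) (act g y) \<Phi>)"
      by (intro mean_scale m LUCB)
    then show "increment x y (average m act (r *\<^sub>R \<Phi>)) = increment x y (r *\<^sub>R average m act \<Phi>)"
      by (simp add: incr increment_scaleR)
  qed
  show "norm (average m act \<Phi>) \<le> norm \<Phi> * 1" for \<Phi>
    by (rule norm_le_increment) (simp_all add: incr mean_increment_bound[OF m act])
qed

definition invariant_increments :: "('g \<Rightarrow> 'x \<Rightarrow> 'x) \<Rightarrow> 'x::metric_space Lip_mod set" where
  "invariant_increments act = {\<Phi>. \<forall>g x y. increment (act g x) (act g y) \<Phi> = increment x y \<Phi>}"

text \<open>Moving \<open>x\<close> and \<open>y\<close> by \<open>h\<close> right-translates the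
  function being averaged, which an invariant mean ignores. If the increments are already invariant,
  that function is constant and averaging returns its value.\<close>

lemma complemented_invariant_increments:
  fixes act :: "'g::topological_group_add \<Rightarrow> 'x::metric_space \<Rightarrow> 'x"
  assumes "amenable TYPE('g)" and act: "continuous_isometric_action act"
  shows "complemented (invariant_increments act)"
proof -
  obtain m :: "('g \<Rightarrow> real) \<Rightarrow> real" where m: "mean_on_LUCB m"
    and inv: "\<And>\<phi> h. \<phi> \<in> LUCB \<Longrightarrow> m (\<lambda>g. \<phi> (g + h)) = m \<phi>"
    using assms(1) by (auto simp: amenable_def)
  note incr = increment_average[OF m act]
  have in_A: "average m act \<Phi> \<in> invariant_increments act" for \<Phi>
    using inv[OF increment_in_LUCB[OF act]] act
    by (simp add: invariant_increments_def incr continuous_isometric_action_def)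
  have fix_A: "average m act \<Phi> = \<Phi>" if "\<Phi> \<in> invariant_increments act" for \<Phi>
    using that by (intro Lip_mod_eqI) (simp add: invariant_increments_def incr mean_const[OF m])
  show ?thesis
  proof (rule complementedI[OF bounded_linear_average[OF m act]])
    show "average m act (average m act \<Phi>) = average m act \<Phi>" for \<Phi>
      by (rule fix_A[OF in_A])
    show "range (average m act) = invariant_increments act"
      using in_A fix_A by (metis image_subset_iff subsetI subset_antisym rangeI)
  qed
qed

section \<open>The homomorphism of an invariant increment\<close>

text \<open>The increment from \<open>x\<close> to \<open>act (g + h) x\<close> splits at
  \<open>act g x\<close>; by invariance the outer piece equals the increment from \<open>x\<close>
  to \<open>act h x\<close>.\<close>

lemma increment_orbit_hom:
  assumes act: "continuous_isometric_action act" and \<Phi>: "\<Phi> \<in> invariant_increments act"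
  shows "(\<lambda>g. increment (act g x) x \<Phi>) \<in> real_homs"
proof -
  have "increment (act (g + h) x) x \<Phi> = increment (act g x) x \<Phi> + increment (act h x) x \<Phi>" for g h
  proof -
    have "increment (act (g + h) x) x \<Phi>
      = increment (act g (act h x)) (act g x) \<Phi> + increment (act g x) x \<Phi>"
      using act by (simp add: increment_trans continuous_isometric_action_def)
    then show ?thesis using \<Phi> by (simp add: invariant_increments_def)
  qed
  moreover have "continuous_on UNIV (\<lambda>g. increment (act g x) x \<Phi>)"
  proof -
    have "(norm \<Phi>)-lipschitz_on UNIV (\<lambda>y. increment y x \<Phi>)"
    proof (rule lipschitz_onI)
      fix y z
      have "increment y x \<Phi> - increment z x \<Phi> = increment y z \<Phi>"
        by transfer simp
      then show "dist (increment y x \<Phi>) (increment z x \<Phi>) \<le> norm \<Phi> * dist y z"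
        using increment_bound[of y z \<Phi>] by (simp add: dist_real_def)
    qed simp
    from continuous_on_compose2[OF lipschitz_on_continuous_on[OF this] continuous_orbit_map[OF act, of x]]
    show ?thesis by simp
  qed
  ultimately show ?thesis by (simp add: real_homs_def)
qed

text \<open>Going around the points \<open>x\<close>, \<open>act g x\<close>,
  \<open>act g y\<close>, \<open>y\<close>: vanishing along both orbits forces invariance, and
  invariance carries vanishing from \<open>x0\<close> to every \<open>x\<close>.\<close>

lemma constant_on_orbits_eq_kernel:
  assumes act: "continuous_isometric_action act"
  shows "{\<Phi>. constant_on_orbits act \<Phi>}
    = {\<Phi> \<in> invariant_increments act. \<forall>g. increment (act g x0) x0 \<Phi> = 0}"
proof (intro set_eqI iffI)
  have const_iff: "constant_on_orbits act \<Phi> \<longleftrightarrow> (\<forall>g x. increment (act g x) x \<Phi> = 0)" for \<Phi>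
    using act by (intro constant_on_orbits_iff) (simp add: continuous_isometric_action_def)
  have expand: "increment (act g x) x \<Phi>
      = increment (act g x) (act g y) \<Phi> + increment (act g y) y \<Phi> - increment x y \<Phi>" for g x y \<Phi>
    by transfer simp
  fix \<Phi>
  {
    assume "\<Phi> \<in> {\<Phi>. constant_on_orbits act \<Phi>}"
    then have 0: "\<And>g x. increment (act g x) x \<Phi> = 0" by (simp add: const_iff)
    then have "increment (act g x) (act g y) \<Phi> = increment x y \<Phi>" for g x y
      using expand[of g x \<Phi> y] by simp
    with 0 show "\<Phi> \<in> {\<Phi> \<in> invariant_increments act. \<forall>g. increment (act g x0) x0 \<Phi> = 0}"
      by (simp add: invariant_increments_def)
  next
    assume "\<Phi> \<in> {\<Phi> \<in> invariant_increments act. \<forall>g. increment (act g x0) x0 \<Phi> = 0}"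
    then have "increment (act g x) x \<Phi> = 0" for g x
      using expand[of g x \<Phi> x0] by (simp add: invariant_increments_def)
    then show "\<Phi> \<in> {\<Phi>. constant_on_orbits act \<Phi>}" by (simp add: const_iff)
  }
qed

theorem theorem1p4:
  fixes act :: "'g::topological_group_add \<Rightarrow> 'x::metric_space \<Rightarrow> 'x"
  assumes "amenable TYPE('g)"
    and "continuous_isometric_action act"
    and "finite_dim_real_homs TYPE('g)"
  shows "complemented {\<Phi> :: 'x Lip_mod. constant_on_orbits act \<Phi>}"
proof -
  obtain B :: "('g \<Rightarrow> real) set" where B: "finite B"
    "\<And>\<eta>. \<eta> \<in> real_homs \<Longrightarrow> \<exists>c. \<forall>g. \<eta> g = (\<Sum>b\<in>B. c b * b g)"
    using assms(3) by (auto simp: finite_dim_real_homs_def)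
  define x0 :: 'x where "x0 = undefined"
  have "complemented {\<Phi> \<in> invariant_increments act. \<forall>g. increment (act g x0) x0 \<Phi> = 0}"
  \<comment> \<open>The finite spanning set of homomorphisms is indexed by itself.\<close>
  proof (rule complemented_common_kernel[OF B(1), where f = "\<lambda>b. b"])
    show "complemented (invariant_increments act)"
      by (rule complemented_invariant_increments[OF assms(1,2)])
    show "bounded_linear (increment (act g x0) x0)" for g
      by (rule bounded_linear_increment)
    show "\<exists>c. \<forall>g. increment (act g x0) x0 \<Phi> = (\<Sum>b\<in>B. c b * b g)"
      if "\<Phi> \<in> invariant_increments act" for \<Phi>
      by (rule B(2)[OF increment_orbit_hom[OF assms(2) that]])
  qed
  then show ?thesis
    by (simp only: constant_on_orbits_eq_kernel[OF assms(2), of x0])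
qed

end
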